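(* Let $K$ be a subcomplex of a finite simplicial complex $L$, let $k\ge 0$, and let $[\alpha]_L\in \mathrm{H}^k(L)$ be born between $K$ and $L$. Then the birth cochain for $[\alpha]_L$ from $K$ to $L$ is the unique element of $$\operatorname*{arg\,min}_{\alpha' \in \mathrm{Z}^k(L,K)} \left\{ \|\alpha'\|_2 \;\middle|\; q^\#([\alpha']_{(L,K)}) = [\alpha]_{L} \right\}.$$
   Context: All simplicial complexes are finite and all (co)homology has real coefficients. $\mathrm{C}^k(X)$ is the space of real-valued functions on the set of $k$-simplices of $X$ (with orientations fixed), with inner product $\langle\alpha,\beta\rangle=\sum_\sigma \alpha(\sigma)\beta(\sigma)$ and norm $\|\cdot\|_2$; $\delta_X^k:\mathrm{C}^k(X)\to \mathrm{C}^{k+1}(X)$ is the coboundary operator, and $[\alpha]_X\in \mathrm{H}^k(X)$ is the class of a cocycle $\alpha$. For $\varphi\in \mathrm{C}^k(L)$, $\varphi|_K$ is its restriction to the $k$-simplices of $K$. Relative cochains: $\mathrm{C}^k(L,K)=\{\varphi\in \mathrm{C}^k(L) : \varphi|_K=0\}$, with coboundary and norm induced from $L$; $\mathrm{Z}^k(L,K)$ denotes the relative cocycles, $\mathrm{H}^k(L,K)$ the relative cohomology, and $[\cdot]_{(L,K)}$ relative classes. The map $q^\#:\mathrm{H}^k(L,K)\to \mathrm{H}^k(L)$ is induced by the inclusion $\mathrm{C}^k(L,K)\subseteq \mathrm{C}^k(L)$. A class $[\alpha]_L\in \mathrm{H}^k(L)$ is born between $K$ and $L$ if $[\alpha|_K]=0\in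 \mathrm{H}^k(K)$. In that case its birth cochain from $K$ to $L$ is the unique element of $\operatorname{arg\,min}_{\alpha'\in \mathrm{C}^k(L)}\{\|\alpha'\|_2 : \alpha'|_K=0,\ \alpha'\in[\alpha]_L\}$. *)

theory Defs
  imports
    Complex_Main
    "HOL-Library.Function_Algebras"
    "HOL-Combinatorics.Permutations"
begin

section \<open>Finite simplicial complexes and orientations\<close>

text \<open>Complexes are abstract and do not contain the empty simplex, so cohomology is unreduced.\<close>

definition simplicial_complex :: "'a set set \<Rightarrow> bool" where
  "simplicial_complex X \<longleftrightarrow>
     finite X \<and>
     (\<forall>\<sigma>\<in>X. finite \<sigma> \<and> \<sigma> \<noteq> {}) \<and>
     (\<forall>\<sigma>\<in>X. \<forall>\<tau>. \<tau> \<subseteq> \<sigma> \<and> \<tau> \<noteq> {} \<longrightarrow> \<tau> \<in> X)"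

definition subcomplex :: "'a set set \<Rightarrow> 'a set set \<Rightarrow> bool" where
  "subcomplex K L \<longleftrightarrow> simplicial_complex K \<and> simplicial_complex L \<and> K \<subseteq> L"

definition simplices :: "'a set set \<Rightarrow> nat \<Rightarrow> 'a set set" where
  "simplices X k = {\<sigma> \<in> X. card \<sigma> = k + 1}"

text \<open>
  The orientations are fixed by choosing an ordering of the vertices of each simplex, independently
  for different simplices. A subcomplex of an oriented complex carries the inherited orientations.
\<close>

definition orientation :: "'a set set \<Rightarrow> ('a set \<Rightarrow> 'a list) \<Rightarrow> bool" where
  "orientation X ori \<longleftrightarrow> (\<forall>\<sigma>\<in>X. distinct (ori \<sigma>) \<and> set (ori \<sigma>) = \<sigma>)"

text \<open>The sign of the permutation carrying one ordering of a vertex set to another.\<close>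

definition ordering_sign :: "'a list \<Rightarrow> 'a list \<Rightarrow> real" where
  "ordering_sign xs ys = of_int (sign (THE p. p permutes set xs \<and> map p xs = ys))"


section \<open>Cochains\<close>

type_synonym 'a cochain = "'a set \<Rightarrow> real"

text \<open>Functions on the \<open>k\<close>-simplices are represented by their extensions by zero.\<close>

definition cochains :: "'a set set \<Rightarrow> nat \<Rightarrow> 'a cochain set" where
  "cochains X k = {\<phi>. \<forall>\<sigma>. \<sigma> \<notin> simplices X k \<longrightarrow> \<phi> \<sigma> = 0}"

definition cochain_inner :: "'a set set \<Rightarrow> nat \<Rightarrow> 'a cochain \<Rightarrow> 'a cochain \<Rightarrow> real" where
  "cochain_inner X k \<phi> \<psi> = (\<Sum>\<sigma>\<in>simplices X k. \<phi> \<sigma> * \<psi> \<sigma>)"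

definition cochain_norm :: "'a set set \<Rightarrow> nat \<Rightarrow> 'a cochain \<Rightarrow> real" where
  "cochain_norm X k \<phi> = sqrt (cochain_inner X k \<phi> \<phi>)"

definition cochain_restrict :: "'a set set \<Rightarrow> nat \<Rightarrow> 'a cochain \<Rightarrow> 'a cochain" where
  "cochain_restrict K k \<phi> = (\<lambda>\<sigma>. if \<sigma> \<in> simplices K k then \<phi> \<sigma> else 0)"

text \<open>The value of a cochain on a simplex whose vertices are listed in an arbitrary order.\<close>

definition cochain_eval :: "('a set \<Rightarrow> 'a list) \<Rightarrow> 'a cochain \<Rightarrow> 'a list \<Rightarrow> real" where
  "cochain_eval ori \<phi> xs = ordering_sign xs (ori (set xs)) * \<phi> (set xs)"

text \<open>
  The usual formula: on a simplex oriented by the vertex list \<open>xs\<close>, the coboundary of \<open>\<phi>\<close> is the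
  alternating sum over \<open>i\<close> of the values of \<open>\<phi>\<close> on \<open>xs\<close> with its \<open>i\<close>-th vertex omitted.
\<close>

definition coboundary ::
  "('a set \<Rightarrow> 'a list) \<Rightarrow> 'a set set \<Rightarrow> nat \<Rightarrow> 'a cochain \<Rightarrow> 'a cochain" where
  "coboundary ori X k \<phi> =
     (\<lambda>\<tau>. if \<tau> \<in> simplices X (Suc k)
          then \<Sum>i<length (ori \<tau>).
                 (-1) ^ i * cochain_eval ori \<phi> (take i (ori \<tau>) @ drop (Suc i) (ori \<tau>))
          else 0)"


section \<open>Cohomology\<close>

definition cocycles :: "('a set \<Rightarrow> 'a list) \<Rightarrow> 'a set set \<Rightarrow> nat \<Rightarrow> 'a cochain set" where
  "cocycles ori X k = {\<phi> \<in> cochains X k. coboundary ori X k \<phi> = 0}"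

text \<open>There are no cochains in degree \<open>-1\<close>.\<close>

fun coboundaries :: "('a set \<Rightarrow> 'a list) \<Rightarrow> 'a set set \<Rightarrow> nat \<Rightarrow> 'a cochain set" where
  "coboundaries ori X 0 = {0}"
| "coboundaries ori X (Suc k) = coboundary ori X k ` cochains X k"

definition cohomologous ::
  "'a cochain set \<Rightarrow> 'a cochain set \<Rightarrow> ('a cochain \<times> 'a cochain) set" where
  "cohomologous Z B = {(\<phi>, \<psi>). \<phi> \<in> Z \<and> \<psi> \<in> Z \<and> \<phi> - \<psi> \<in> B}"

definition cohomology :: "('a set \<Rightarrow> 'a list) \<Rightarrow> 'a set set \<Rightarrow> nat \<Rightarrow> 'a cochain set set" where
  "cohomology ori X k = cocycles ori X k // cohomologous (cocycles ori X k) (coboundaries ori X k)"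

definition cohomology_class ::
  "('a set \<Rightarrow> 'a list) \<Rightarrow> 'a set set \<Rightarrow> nat \<Rightarrow> 'a cochain \<Rightarrow> 'a cochain set" where
  "cohomology_class ori X k \<phi> =
     cohomologous (cocycles ori X k) (coboundaries ori X k) `` {\<phi>}"


section \<open>Relative cohomology of a pair \<open>K \<subseteq> L\<close>\<close>

definition rel_cochains :: "'a set set \<Rightarrow> 'a set set \<Rightarrow> nat \<Rightarrow> 'a cochain set" where
  "rel_cochains L K k = {\<phi> \<in> cochains L k. cochain_restrict K k \<phi> = 0}"

definition rel_cocycles ::
  "('a set \<Rightarrow> 'a list) \<Rightarrow> 'a set set \<Rightarrow> 'a set set \<Rightarrow> nat \<Rightarrow> 'a cochain set" where
  "rel_cocycles ori L K k = {\<phi> \<in> rel_cochains L K k. coboundary ori L k \<phi> = 0}"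

fun rel_coboundaries ::
  "('a set \<Rightarrow> 'a list) \<Rightarrow> 'a set set \<Rightarrow> 'a set set \<Rightarrow> nat \<Rightarrow> 'a cochain set" where
  "rel_coboundaries ori L K 0 = {0}"
| "rel_coboundaries ori L K (Suc k) = coboundary ori L k ` rel_cochains L K k"

definition rel_cohomology_class ::
  "('a set \<Rightarrow> 'a list) \<Rightarrow> 'a set set \<Rightarrow> 'a set set \<Rightarrow> nat \<Rightarrow> 'a cochain \<Rightarrow> 'a cochain set" where
  "rel_cohomology_class ori L K k \<phi> =
     cohomologous (rel_cocycles ori L K k) (rel_coboundaries ori L K k) `` {\<phi>}"

text \<open>
  The map \<open>q\<^sup>#\<close> from the relative to the absolute cohomology of \<open>L\<close>, in the usual form of a map on
  a quotient: all representatives of a relative class have the same absolute class.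
\<close>

definition q_sharp ::
  "('a set \<Rightarrow> 'a list) \<Rightarrow> 'a set set \<Rightarrow> nat \<Rightarrow> 'a cochain set \<Rightarrow> 'a cochain set" where
  "q_sharp ori L k c = (\<Union>\<phi>\<in>c. cohomology_class ori L k \<phi>)"


section \<open>Birth cochains\<close>

text \<open>
  The restriction to \<open>K\<close> of a coboundary of \<open>L\<close> is a coboundary of \<open>K\<close>, so the choice of the
  representative of \<open>c\<close> is immaterial.
\<close>

definition born_between ::
  "('a set \<Rightarrow> 'a list) \<Rightarrow> 'a set set \<Rightarrow> 'a set set \<Rightarrow> nat \<Rightarrow> 'a cochain set \<Rightarrow> bool" where
  "born_between ori K L k c \<longleftrightarrow>
     c \<in> cohomology ori L k \<and>
     (\<exists>\<alpha>\<in>c. cohomology_class ori K k (cochain_restrict K k \<alpha>) = cohomology_class ori K k 0)"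

definition birth_cochain ::
  "('a set \<Rightarrow> 'a list) \<Rightarrow> 'a set set \<Rightarrow> 'a set set \<Rightarrow> nat \<Rightarrow> 'a cochain set \<Rightarrow> 'a cochain" where
  "birth_cochain ori K L k c =
     (THE \<alpha>. is_arg_min (cochain_norm L k)
               (\<lambda>\<alpha>'. \<alpha>' \<in> cochains L k \<and> cochain_restrict K k \<alpha>' = 0 \<and> \<alpha>' \<in> c) \<alpha>)"

end

theory Submission
  imports Defs
begin

text \<open>
  The two minimisation problems have the same feasible set: a cochain of \<open>L\<close> that vanishes on \<open>K\<close>
  and lies in the class of \<open>\<alpha>\<close> is a relative cocycle, and \<open>q\<^sup>#\<close> sends its relative class to its
  absolute one. This set is a translate of the space of coboundaries of \<open>L\<close> vanishing on \<open>K\<close>. It is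
  nonempty because a cochain of \<open>K\<close> whose coboundary is \<open>\<alpha>|\<^sub>K\<close> can be extended by zero to \<open>L\<close> and its
  coboundary subtracted from \<open>\<alpha>\<close>, which leaves a cocycle because \<open>\<delta>\<delta> = 0\<close>. Orthogonal projection
  then yields exactly one element of minimal norm.
\<close>

section \<open>The sign between two orderings\<close>

text \<open>A permutation of \<open>set xs\<close> fixes everything outside \<open>set xs\<close>,
  so its values on the list determine it. This evaluates the definite description inside
  \<open>ordering_sign\<close>.\<close>

lemma ordering_sign_map:
  assumes "p permutes set xs"
  shows "ordering_sign xs (map p xs) = of_int (sign p)"
proof -
  have "(THE q. q permutes set xs \<and> map q xs = map p xs) = p"
  proof (rule the_equality)
    fix q assume q: "q permutes set xs \<and> map q xs = map p xs"
    show "q = p"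
    proof
      fix x show "q x = p x"
        using q assms by (cases "x \<in> set xs") (auto simp: permutes_not_in)
    qed
  qed (use assms in auto)
  then show ?thesis
    by (simp add: ordering_sign_def)
qed

lemma permutation_between_orderings:
  assumes "distinct xs" "distinct ys" "set xs = set ys"
  obtains p where "p permutes set xs" "map p xs = ys"
proof -
  have len: "length xs = length ys"
    using assms by (metis distinct_card)
  \<comment> \<open>\<open>p\<close> sends each entry of \<open>xs\<close> to the entry of
    \<open>ys\<close> at the same position and is the identity elsewhere. It maps the finite set
    \<open>set xs\<close> onto itself, hence is injective there.\<close>
  define p where "p x = (case map_of (zip xs ys) x of Some y \<Rightarrow> y | None \<Rightarrow> x)" for x
  have map: "map p xs = ys"
    using len assms(1) by (intro nth_equalityI) (auto simp: p_def map_of_zip_nth)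
  then have "p ` set xs = set xs"
    using assms(3) by (metis image_set)
  then have "bij_betw p (set xs) (set xs)"
    by (simp add: bij_betw_def finite_surj_inj)
  moreover have "p x = x" if "x \<notin> set xs" for x
    using that len by (auto simp: p_def split: option.split dest!: map_of_SomeD set_zip_leftD)
  ultimately have "p permutes set xs"
    by (rule bij_imp_permutes)
  with map that show ?thesis by blast
qed

text \<open>The permutation from \<open>xs\<close> to \<open>zs\<close> is the composite of the two
  intermediate ones, and \<open>sign\<close> is multiplicative.\<close>

lemma ordering_sign_trans:
  assumes "distinct xs" "distinct ys" "distinct zs" "set xs = set ys" "set ys = set zs"
  shows "ordering_sign xs ys * ordering_sign ys zs = ordering_sign xs zs"
proof -
  obtain p where p: "p permutes set xs" "map p xs = ys"
    using permutation_between_orderings assms by metis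
  obtain q where q: "q permutes set ys" "map q ys = zs"
    using permutation_between_orderings assms by metis
  have "q \<circ> p permutes set xs"
    using p q assms by (simp add: permutes_compose)
  moreover have "map (q \<circ> p) xs = zs"
    using p q by auto
  moreover have "sign (q \<circ> p) = sign q * sign p"
    using p q by (intro sign_compose) (auto intro: permutation_permutes[THEN iffD2])
  ultimately show ?thesis
    using ordering_sign_map[OF p(1)] ordering_sign_map[OF q(1)] ordering_sign_map[of "q \<circ> p" xs] p q
    by simp
qed

text \<open>The permutation carrying \<open>xs\<close> to \<open>ys\<close> fixes \<open>x\<close>,
  which lies outside \<open>set xs\<close>, so the same permutation serves for the longer
  lists.\<close>

lemma ordering_sign_Cons:
  assumes "distinct (x # xs)" "distinct (x # ys)" "set xs = set ys"
  shows "ordering_sign (x # xs) (x # ys) = ordering_sign xs ys"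
proof -
  obtain p where p: "p permutes set xs" "map p xs = ys"
    using permutation_between_orderings assms by (metis distinct.simps(2))
  have "p permutes set (x # xs)"
    using p by (auto intro: permutes_subset)
  moreover have "p x = x"
    using p assms by (simp add: permutes_not_in)
  ultimately show ?thesis
    using ordering_sign_map[OF p(1)] ordering_sign_map[of p "x # xs"] p by simp
qed

lemma ordering_sign_refl: "ordering_sign xs xs = 1"
  using ordering_sign_map[of id xs] by (simp add: permutes_id)

lemma ordering_sign_swap:
  assumes "distinct (x # y # xs)"
  shows "ordering_sign (x # y # xs) (y # x # xs) = -1"
proof -
  let ?p = "transpose x y"
  have "?p permutes set (x # y # xs)"
    by (rule permutes_swap_id) auto
  moreover have "map ?p (x # y # xs) = y # x # xs"
    using assms by (auto intro!: map_idI simp: transpose_def)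
  moreover have "sign ?p = -1"
    using assms by (simp add: sign_swap_id)
  ultimately show ?thesis
    using ordering_sign_map[of ?p "x # y # xs"] by simp
qed

text \<open>The vertex \<open>y\<close> passes the entries of \<open>xs\<close> one at a time, and
  each adjacent swap contributes a factor \<open>-1\<close>.\<close>

lemma ordering_sign_move_to_front:
  assumes "distinct (xs @ y # ys)"
  shows "ordering_sign (xs @ y # ys) (y # xs @ ys) = (-1) ^ length xs"
  using assms
proof (induction xs)
  case Nil
  then show ?case by (simp add: ordering_sign_refl)
next
  case (Cons x xs)
  have "ordering_sign (x # xs @ y # ys) (x # y # xs @ ys) = (-1) ^ length xs"
    using Cons by (subst ordering_sign_Cons) auto
  moreover have "ordering_sign (x # y # xs @ ys) (y # x # xs @ ys) = -1"
    using Cons.prems by (intro ordering_sign_swap) auto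
  moreover have "ordering_sign (x # xs @ y # ys) (x # y # xs @ ys)
      * ordering_sign (x # y # xs @ ys) (y # x # xs @ ys)
      = ordering_sign (x # xs @ y # ys) (y # x # xs @ ys)"
    using Cons.prems by (intro ordering_sign_trans) auto
  ultimately show ?case by simp
qed


section \<open>The coboundary operator\<close>

lemma orientationD:
  assumes "orientation X ori" "\<sigma> \<in> X"
  shows "distinct (ori \<sigma>)" "set (ori \<sigma>) = \<sigma>"
  using assms by (auto simp: orientation_def)

lemma simplex_remove_vertex:
  assumes "simplicial_complex X" "\<tau> \<in> simplices X (Suc k)" "v \<in> \<tau>"
  shows "\<tau> - {v} \<in> simplices X k"
proof -
  have "\<tau> \<in> X" "card \<tau> = Suc (Suc k)" "finite \<tau>"
    using assms by (auto simp: simplices_def simplicial_complex_def)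
  then have card: "card (\<tau> - {v}) = Suc k"
    using assms(3) by simp
  \<comment> \<open>A complex is closed only under nonempty faces, so nonemptiness is read off from
    the vertex count.\<close>
  then have "\<tau> - {v} \<noteq> {}"
    by (metis card_gt_0_iff zero_less_Suc)
  moreover have "\<forall>\<sigma>\<in>X. \<forall>\<tau>. \<tau> \<subseteq> \<sigma> \<and> \<tau> \<noteq> {} \<longrightarrow> \<tau> \<in> X"
    using assms(1) unfolding simplicial_complex_def by (elim conjE)
  ultimately have "\<tau> - {v} \<in> X"
    using \<open>\<tau> \<in> X\<close> by (meson Diff_subset)
  then show ?thesis
    using card by (simp add: simplices_def)
qed

text \<open>
  Moving the omitted vertex to the front absorbs the alternating sign into the ordering sign, so the
  coboundary becomes a sum over vertices that does not mention positions.
\<close>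

lemma coboundary_vertex_sum:
  assumes "simplicial_complex X" "orientation X ori" "\<tau> \<in> simplices X (Suc k)"
  shows "coboundary ori X k \<phi> \<tau> =
    (\<Sum>v\<in>\<tau>. ordering_sign (ori \<tau>) (v # ori (\<tau> - {v})) * \<phi> (\<tau> - {v}))"
proof -
  let ?xs = "ori \<tau>"
  have xs: "distinct ?xs" "set ?xs = \<tau>"
    using assms by (auto simp: orientation_def simplices_def)
  have term_eq: "(-1) ^ i * cochain_eval ori \<phi> (take i ?xs @ drop (Suc i) ?xs) =
      ordering_sign ?xs (?xs ! i # ori (\<tau> - {?xs ! i})) * \<phi> (\<tau> - {?xs ! i})"
    if i: "i < length ?xs" for i
  proof -
    let ?v = "?xs ! i" and ?ys = "take i ?xs @ drop (Suc i) ?xs"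
    have split: "?xs = take i ?xs @ ?v # drop (Suc i) ?xs"
      using i by (rule id_take_nth_drop)
    have dist: "distinct (take i ?xs @ ?v # drop (Suc i) ?xs)"
      using xs(1) unfolding split[symmetric] .
    have "set ?xs = insert ?v (set ?ys)"
      by (subst split) simp
    moreover have "?v \<notin> set ?ys"
      using dist by auto
    ultimately have set_ys: "set ?ys = \<tau> - {?v}"
      using xs(2) by (metis Diff_insert_absorb)
    have "?v \<in> \<tau>"
      using nth_mem[OF i] unfolding xs(2) .
    then have "\<tau> - {?v} \<in> X"
      using simplex_remove_vertex[OF assms(1,3)] by (auto simp: simplices_def)
    note ori = orientationD[OF assms(2) this]
    \<comment> \<open>The reordering factors into moving the omitted vertex to the front and then
      rearranging the remaining vertices into the chosen order of the face. The second sign is the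
      one in \<open>cochain_eval\<close>.\<close>
    have "ordering_sign ?xs (?v # ?ys) = (-1) ^ i"
      using ordering_sign_move_to_front[OF dist] i unfolding split[symmetric] by simp
    moreover have "ordering_sign (?v # ?ys) (?v # ori (\<tau> - {?v})) = ordering_sign ?ys (ori (\<tau> - {?v}))"
      using dist ori set_ys by (intro ordering_sign_Cons) auto
    moreover have "ordering_sign ?xs (?v # ?ys) * ordering_sign (?v # ?ys) (?v # ori (\<tau> - {?v})) =
        ordering_sign ?xs (?v # ori (\<tau> - {?v}))"
      using xs dist ori set_ys \<open>?v \<in> \<tau>\<close> by (intro ordering_sign_trans) auto
    ultimately show ?thesis
      unfolding cochain_eval_def set_ys by (simp add: mult.assoc)
  qed
  have "bij_betw (\<lambda>i. ?xs ! i) {..<length ?xs} \<tau>"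
    using bij_betw_nth[OF xs(1)] xs(2) by auto
  note reindex = sum.reindex_bij_betw[OF this]
  have "coboundary ori X k \<phi> \<tau> = (\<Sum>i<length ?xs.
      ordering_sign ?xs (?xs ! i # ori (\<tau> - {?xs ! i})) * \<phi> (\<tau> - {?xs ! i}))"
    using assms(3) term_eq by (simp add: coboundary_def)
  also have "\<dots> = (\<Sum>v\<in>\<tau>. ordering_sign ?xs (v # ori (\<tau> - {v})) * \<phi> (\<tau> - {v}))"
    by (rule reindex)
  finally show ?thesis .
qed

text \<open>The double coboundary is a sum over ordered pairs of removed vertices. Exchanging the
  two vertices transposes the front of the reordered list and flips the sign, so the sum equals its
  own negative.\<close>

lemma coboundary_coboundary:
  assumes "simplicial_complex X" "orientation X ori"
  shows "coboundary ori X (Suc k) (coboundary ori X k \<phi>) = 0"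
proof
  fix \<tau>
  show "coboundary ori X (Suc k) (coboundary ori X k \<phi>) \<tau> = 0 \<tau>"
  proof (cases "\<tau> \<in> simplices X (Suc (Suc k))")
    case \<tau>: True
    \<comment> \<open>The diagonal is set to \<open>0\<close> so that both indices can range over
      all of \<open>\<tau>\<close>, which makes the later exchange of summations symmetric.\<close>
    define g where "g v w = (if v = w then 0 else
      ordering_sign (ori \<tau>) (v # w # ori (\<tau> - {v, w})) * \<phi> (\<tau> - {v, w}))" for v w
    have fin: "finite \<tau>"
      using \<tau> assms(1) by (auto simp: simplices_def simplicial_complex_def)
    have ori: "distinct (ori \<tau>)" "set (ori \<tau>) = \<tau>"
      using \<tau> orientationD[OF assms(2)] by (auto simp: simplices_def)
    have pair: "distinct (ori (\<tau> - {v, w}))" "set (ori (\<tau> - {v, w})) = \<tau> - {v, w}"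
      if "v \<in> \<tau>" "w \<in> \<tau>" "v \<noteq> w" for v w
    proof -
      have "\<tau> - {v} - {w} \<in> simplices X k"
        using that \<tau> assms(1) by (intro simplex_remove_vertex) auto
      then have "\<tau> - {v, w} \<in> X"
        by (simp add: simplices_def Diff_insert2[symmetric] insert_commute)
      then show "distinct (ori (\<tau> - {v, w}))" "set (ori (\<tau> - {v, w})) = \<tau> - {v, w}"
        using orientationD[OF assms(2)] by auto
    qed
    have inner: "ordering_sign (ori \<tau>) (v # ori (\<tau> - {v})) * coboundary ori X k \<phi> (\<tau> - {v})
        = (\<Sum>w\<in>\<tau>. g v w)" if v: "v \<in> \<tau>" for v
    proof -
      have face: "\<tau> - {v} \<in> simplices X (Suc k)"
        using simplex_remove_vertex[OF assms(1) \<tau> v] .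
      then have ori_v: "distinct (ori (\<tau> - {v}))" "set (ori (\<tau> - {v})) = \<tau> - {v}"
        using orientationD[OF assms(2)] by (auto simp: simplices_def)
      have "ordering_sign (ori \<tau>) (v # ori (\<tau> - {v})) * coboundary ori X k \<phi> (\<tau> - {v})
        = (\<Sum>w\<in>\<tau> - {v}. ordering_sign (ori \<tau>) (v # ori (\<tau> - {v})) *
            (ordering_sign (ori (\<tau> - {v})) (w # ori (\<tau> - {v} - {w})) * \<phi> (\<tau> - {v} - {w})))"
        by (simp add: coboundary_vertex_sum[OF assms face] sum_distrib_left)
      also have "\<dots> = (\<Sum>w\<in>\<tau> - {v}. g v w)"
      proof (rule sum.cong)
        fix w assume w: "w \<in> \<tau> - {v}"
        have diff: "\<tau> - {v} - {w} = \<tau> - {v, w}" by auto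
        note vw = pair[of v w]
        \<comment> \<open>Prefixing \<open>v\<close> turns the sign taken on the face into a sign
          between two orderings of \<open>\<tau>\<close>, so it can be multiplied with the outer
          sign.\<close>
        have "ordering_sign (v # ori (\<tau> - {v})) (v # w # ori (\<tau> - {v, w})) =
            ordering_sign (ori (\<tau> - {v})) (w # ori (\<tau> - {v, w}))"
          using v w ori_v vw by (intro ordering_sign_Cons) auto
        moreover have "ordering_sign (ori \<tau>) (v # ori (\<tau> - {v})) *
            ordering_sign (v # ori (\<tau> - {v})) (v # w # ori (\<tau> - {v, w})) =
            ordering_sign (ori \<tau>) (v # w # ori (\<tau> - {v, w}))"
          using v w ori ori_v vw by (intro ordering_sign_trans) auto
        ultimately show "ordering_sign (ori \<tau>) (v # ori (\<tau> - {v})) *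
            (ordering_sign (ori (\<tau> - {v})) (w # ori (\<tau> - {v} - {w})) * \<phi> (\<tau> - {v} - {w})) = g v w"
          using w unfolding diff g_def by auto
      qed simp
      also have "\<dots> = (\<Sum>w\<in>\<tau>. g v w)"
        using fin by (intro sum.mono_neutral_left) (auto simp: g_def)
      finally show ?thesis .
    qed
    have anti: "g w v = - g v w" if vw: "v \<in> \<tau>" "w \<in> \<tau>" for v w
    proof (cases "v = w")
      case False
      have "ordering_sign (ori \<tau>) (v # w # ori (\<tau> - {v, w})) *
          ordering_sign (v # w # ori (\<tau> - {v, w})) (w # v # ori (\<tau> - {v, w})) =
          ordering_sign (ori \<tau>) (w # v # ori (\<tau> - {v, w}))"
        using vw False ori pair[of v w] by (intro ordering_sign_trans) auto
      moreover have "ordering_sign (v # w # ori (\<tau> - {v, w})) (w # v # ori (\<tau> - {v, w})) = -1"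
        using vw False pair[of v w] by (intro ordering_sign_swap) auto
      ultimately have "ordering_sign (ori \<tau>) (w # v # ori (\<tau> - {v, w})) =
          - ordering_sign (ori \<tau>) (v # w # ori (\<tau> - {v, w}))"
        by simp
      then show ?thesis
        using False by (simp add: g_def insert_commute[of w v])
    qed (simp add: g_def)
    have "(\<Sum>v\<in>\<tau>. \<Sum>w\<in>\<tau>. g v w) = (\<Sum>w\<in>\<tau>. \<Sum>v\<in>\<tau>. g v w)"
      by (rule sum.swap)
    also have "\<dots> = (\<Sum>w\<in>\<tau>. \<Sum>v\<in>\<tau>. - g w v)"
      by (intro sum.cong refl anti)
    also have "\<dots> = - (\<Sum>v\<in>\<tau>. \<Sum>w\<in>\<tau>. g v w)"
      by (simp add: sum_negf)
    finally have "(\<Sum>v\<in>\<tau>. \<Sum>w\<in>\<tau>. g v w) = 0" by linarith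
    then show ?thesis
      by (simp add: coboundary_vertex_sum[OF assms \<tau>] inner)
  qed (simp add: coboundary_def)
qed

section \<open>Linearity of the coboundary and its behaviour under restriction\<close>

lemma coboundary_diff:
  "coboundary ori X k (\<phi> - \<psi>) = coboundary ori X k \<phi> - coboundary ori X k \<psi>"
  by (rule ext) (simp add: coboundary_def cochain_eval_def algebra_simps sum_subtractf)

lemma coboundary_scale:
  "coboundary ori X k (\<lambda>\<sigma>. c * \<phi> \<sigma>) = (\<lambda>\<tau>. c * coboundary ori X k \<phi> \<tau>)"
  by (rule ext) (simp add: coboundary_def cochain_eval_def algebra_simps sum_distrib_left)

lemma coboundary_zero: "coboundary ori X k 0 = 0"
  by (rule ext) (simp add: coboundary_def cochain_eval_def)

lemma coboundary_in_cochains: "coboundary ori X k \<phi> \<in> cochains X (Suc k)"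
  by (simp add: cochains_def coboundary_def)

text \<open>The complex enters \<open>coboundary\<close> only by deciding where the formula is
  replaced by zero, and \<open>K\<close> inherits the orientations of \<open>L\<close>. So
  \<open>\<phi>\<close> may stay unrestricted on the right.\<close>

lemma cochain_restrict_coboundary:
  assumes "K \<subseteq> L"
  shows "cochain_restrict K (Suc k) (coboundary ori L k \<phi>) = coboundary ori K k \<phi>"
  using assms by (auto simp: fun_eq_iff cochain_restrict_def coboundary_def simplices_def)

lemma cochain_restrict_diff:
  "cochain_restrict K k (\<phi> - \<psi>) = cochain_restrict K k \<phi> - cochain_restrict K k \<psi>"
  by (auto simp: fun_eq_iff cochain_restrict_def)

text \<open>In this encoding the inclusion is extension by zero.\<close>

lemma cochains_mono: "K \<subseteq> L \<Longrightarrow> cochains K k \<subseteq> cochains L k"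
  by (auto simp: cochains_def simplices_def)


section \<open>Cohomology classes\<close>

lemma zero_in_coboundaries: "0 \<in> coboundaries ori X k"
proof (cases k)
  case (Suc j)
  have "0 \<in> cochains X j" by (simp add: cochains_def)
  then show ?thesis using Suc coboundary_zero by (metis coboundaries.simps(2) imageI)
qed simp

lemma coboundaries_diff:
  assumes "\<phi> \<in> coboundaries ori X k" "\<psi> \<in> coboundaries ori X k"
  shows "\<phi> - \<psi> \<in> coboundaries ori X k"
proof (cases k)
  case (Suc j)
  obtain a b where "a \<in> cochains X j" "\<phi> = coboundary ori X j a"
    "b \<in> cochains X j" "\<psi> = coboundary ori X j b"
    using assms Suc by auto
  moreover from this have "a - b \<in> cochains X j" by (simp add: cochains_def)
  ultimately show ?thesis using Suc coboundary_diff by (metis coboundaries.simps(2) imageI)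
qed (use assms in auto)

lemma coboundaries_add:
  assumes "\<phi> \<in> coboundaries ori X k" "\<psi> \<in> coboundaries ori X k"
  shows "\<phi> + \<psi> \<in> coboundaries ori X k"
  using coboundaries_diff[OF assms(1) coboundaries_diff[OF zero_in_coboundaries assms(2)]] by simp

lemma coboundaries_scale:
  assumes "\<phi> \<in> coboundaries ori X k"
  shows "(\<lambda>\<sigma>. c * \<phi> \<sigma>) \<in> coboundaries ori X k"
proof (cases k)
  case 0
  then show ?thesis using assms by (simp add: fun_eq_iff)
next
  case (Suc j)
  obtain a where a: "a \<in> cochains X j" "\<phi> = coboundary ori X j a"
    using assms Suc by auto
  then have "(\<lambda>\<sigma>. c * a \<sigma>) \<in> cochains X j" by (simp add: cochains_def)
  then show ?thesis
    unfolding Suc a(2) coboundary_scale[symmetric] coboundaries.simps(2) by (rule imageI)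
qed

lemma coboundaries_subset_cocycles:
  assumes "simplicial_complex X" "orientation X ori"
  shows "coboundaries ori X k \<subseteq> cocycles ori X k"
proof (cases k)
  case 0
  then show ?thesis by (simp add: cocycles_def cochains_def coboundary_zero)
next
  case (Suc j)
  then show ?thesis
    using coboundary_coboundary[OF assms] by (auto simp: cocycles_def coboundary_in_cochains)
qed

lemma cocycles_diff:
  assumes "\<phi> \<in> cocycles ori X k" "\<psi> \<in> cocycles ori X k"
  shows "\<phi> - \<psi> \<in> cocycles ori X k"
  using assms by (simp add: cocycles_def cochains_def coboundary_diff)

lemma mem_cohomology_class:
  "\<psi> \<in> cohomology_class ori X k \<phi> \<longleftrightarrow>
    \<phi> \<in> cocycles ori X k \<and> \<psi> \<in> cocycles ori X k \<and> \<phi> - \<psi> \<in> coboundaries ori X k"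
  by (simp add: cohomology_class_def cohomologous_def)

lemma equiv_cohomologous:
  "equiv (cocycles ori X k) (cohomologous (cocycles ori X k) (coboundaries ori X k))"
proof (rule equivI)
  show "sym (cohomologous (cocycles ori X k) (coboundaries ori X k))"
  proof (rule symI)
    fix \<phi> \<psi> assume "(\<phi>, \<psi>) \<in> cohomologous (cocycles ori X k) (coboundaries ori X k)"
    moreover from this have "0 - (\<phi> - \<psi>) \<in> coboundaries ori X k"
      by (intro coboundaries_diff[OF zero_in_coboundaries]) (simp add: cohomologous_def)
    ultimately show "(\<psi>, \<phi>) \<in> cohomologous (cocycles ori X k) (coboundaries ori X k)"
      by (simp add: cohomologous_def)
  qed
  show "trans (cohomologous (cocycles ori X k) (coboundaries ori X k))"
  proof (rule transI)
    fix \<phi> \<psi> \<chi>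
    assume *: "(\<phi>, \<psi>) \<in> cohomologous (cocycles ori X k) (coboundaries ori X k)"
      "(\<psi>, \<chi>) \<in> cohomologous (cocycles ori X k) (coboundaries ori X k)"
    then have "(\<phi> - \<psi>) + (\<psi> - \<chi>) \<in> coboundaries ori X k"
      by (intro coboundaries_add) (simp_all add: cohomologous_def)
    with * show "(\<phi>, \<chi>) \<in> cohomologous (cocycles ori X k) (coboundaries ori X k)"
      by (simp add: cohomologous_def)
  qed
qed (auto simp: refl_on_def cohomologous_def zero_in_coboundaries)

text \<open>No assumption on \<open>\<psi>\<close> is made: a cochain that is not a cocycle has
  empty class, while the class of \<open>\<phi>\<close> contains \<open>\<phi>\<close>, so both
  sides are then false.\<close>

lemma cohomology_class_eq_iff:
  assumes "\<phi> \<in> cocycles ori X k"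
  shows "cohomology_class ori X k \<psi> = cohomology_class ori X k \<phi> \<longleftrightarrow>
    \<psi> \<in> cohomology_class ori X k \<phi>"
proof
  assume "cohomology_class ori X k \<psi> = cohomology_class ori X k \<phi>"
  moreover have "\<phi> \<in> cohomology_class ori X k \<phi>"
    using assms by (simp add: mem_cohomology_class zero_in_coboundaries)
  ultimately have "\<phi> \<in> cohomology_class ori X k \<psi>"
    by simp
  then show "\<psi> \<in> cohomology_class ori X k \<phi>"
    using equiv_cohomologous[of ori X k] unfolding cohomology_class_def equiv_def
    by (blast dest: symD)
next
  assume "\<psi> \<in> cohomology_class ori X k \<phi>"
  then show "cohomology_class ori X k \<psi> = cohomology_class ori X k \<phi>"
    using equiv_class_eq[OF equiv_cohomologous] unfolding cohomology_class_def by fastforce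
qed

section \<open>Relative classes and the map \<open>q_sharp\<close>\<close>

lemma rel_coboundaries_subset: "rel_coboundaries ori L K k \<subseteq> coboundaries ori L k"
  by (cases k) (auto simp: rel_cochains_def)

lemma zero_in_rel_coboundaries: "0 \<in> rel_coboundaries ori L K k"
proof (cases k)
  case (Suc j)
  have "0 \<in> rel_cochains L K j"
    by (auto simp: rel_cochains_def cochains_def cochain_restrict_def fun_eq_iff)
  then show ?thesis using Suc coboundary_zero by (metis rel_coboundaries.simps(2) imageI)
qed simp

text \<open>Relative coboundaries are coboundaries of \<open>L\<close>, so all sets in the union
  coincide; the union is over a nonempty set because \<open>\<phi>\<close> represents its own
  class.\<close>

lemma q_sharp_rel_cohomology_class:
  assumes "\<phi> \<in> rel_cocycles ori L K k"
  shows "q_sharp ori L k (rel_cohomology_class ori L K k \<phi>) = cohomology_class ori L k \<phi>"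
proof -
  have "rel_cocycles ori L K k \<subseteq> cocycles ori L k"
    by (auto simp: rel_cocycles_def rel_cochains_def cocycles_def)
  then have "cohomology_class ori L k \<psi> = cohomology_class ori L k \<phi>"
    if "\<psi> \<in> rel_cohomology_class ori L K k \<phi>" for \<psi>
    using that assms rel_coboundaries_subset[of ori L K k]
    by (subst cohomology_class_eq_iff)
      (auto simp: mem_cohomology_class rel_cohomology_class_def cohomologous_def)
  moreover have "\<phi> \<in> rel_cohomology_class ori L K k \<phi>"
    using assms by (simp add: rel_cohomology_class_def cohomologous_def zero_in_rel_coboundaries)
  ultimately show ?thesis
    unfolding q_sharp_def by blast
qed

text \<open>This matches the two constraints. For a relative cocycle the condition on
  \<open>q_sharp\<close> becomes an equality of absolute classes, which is membership in the class
  of \<open>\<alpha>\<close>.\<close>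

lemma rel_cocycle_class_iff:
  assumes "\<alpha> \<in> cocycles ori L k"
  shows "\<beta> \<in> rel_cocycles ori L K k \<and>
      q_sharp ori L k (rel_cohomology_class ori L K k \<beta>) = cohomology_class ori L k \<alpha> \<longleftrightarrow>
    \<beta> \<in> cochains L k \<and> cochain_restrict K k \<beta> = 0 \<and> \<beta> \<in> cohomology_class ori L k \<alpha>"
proof -
  have "\<beta> \<in> rel_cocycles ori L K k"
    if "cochain_restrict K k \<beta> = 0" "\<beta> \<in> cohomology_class ori L k \<alpha>"
    using that by (simp add: mem_cohomology_class rel_cocycles_def rel_cochains_def cocycles_def)
  moreover have "\<beta> \<in> cochains L k \<and> cochain_restrict K k \<beta> = 0"
    if "\<beta> \<in> rel_cocycles ori L K k"
    using that by (simp add: rel_cocycles_def rel_cochains_def)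
  ultimately show ?thesis
    using cohomology_class_eq_iff[OF assms] q_sharp_rel_cohomology_class by metis
qed

lemma born_between_representative:
  assumes "subcomplex K L" "orientation L ori" "\<alpha> \<in> cocycles ori L k"
    and "born_between ori K L k (cohomology_class ori L k \<alpha>)"
  obtains \<gamma> where "\<gamma> \<in> cohomology_class ori L k \<alpha>" "cochain_restrict K k \<gamma> = 0"
proof -
  have KL: "K \<subseteq> L" "simplicial_complex K" "simplicial_complex L"
    using assms(1) by (auto simp: subcomplex_def)
  obtain \<phi> where \<phi>: "\<phi> \<in> cohomology_class ori L k \<alpha>"
    and \<phi>_K: "cohomology_class ori K k (cochain_restrict K k \<phi>) = cohomology_class ori K k 0"
    using assms(4) by (auto simp: born_between_def)
  have "0 \<in> cocycles ori K k"
    by (simp add: cocycles_def cochains_def coboundary_zero)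
  \<comment> \<open>Since \<open>0\<close> lies in its own class, the equality of classes places it
    in the class of the restriction; unfolding membership shows that the restriction is a coboundary
    of \<open>K\<close>.\<close>
  then have "0 \<in> cohomology_class ori K k (cochain_restrict K k \<phi>)"
    unfolding \<phi>_K by (simp add: mem_cohomology_class zero_in_coboundaries)
  then have bd: "cochain_restrict K k \<phi> \<in> coboundaries ori K k"
    by (simp add: mem_cohomology_class)
  \<comment> \<open>\<open>\<eta>\<close> is the correction term: subtracting it from
    \<open>\<phi>\<close> keeps the class and kills the values on \<open>K\<close>. In degree
    \<open>0\<close> the only coboundary is \<open>0\<close>, so \<open>\<eta> = 0\<close> works;
    otherwise a primitive \<open>b\<close> on \<open>K\<close>, read as a cochain of
    \<open>L\<close>, gives it.\<close>
  obtain \<eta> where \<eta>: "\<eta> \<in> coboundaries ori L k" "cochain_restrict K k \<eta> = cochain_restrict K k \<phi>"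
  proof (cases k)
    case 0
    with bd have "cochain_restrict K k \<phi> = 0" by simp
    moreover have "cochain_restrict K k 0 = 0"
      by (simp add: cochain_restrict_def fun_eq_iff)
    ultimately show ?thesis using that zero_in_coboundaries by metis
  next
    case (Suc j)
    with bd obtain b where b: "b \<in> cochains K j" "cochain_restrict K k \<phi> = coboundary ori K j b"
      by auto
    then show ?thesis
      using that[of "coboundary ori L j b"] Suc cochains_mono[OF KL(1)]
        cochain_restrict_coboundary[OF KL(1)] by auto
  qed
  have "\<phi> - \<eta> \<in> cocycles ori L k"
    using \<phi> \<eta>(1) coboundaries_subset_cocycles[OF KL(3) assms(2)]
    by (intro cocycles_diff) (auto simp: mem_cohomology_class)
  moreover have "(\<alpha> - \<phi>) + \<eta> \<in> coboundaries ori L k"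
    using \<phi> \<eta>(1) by (intro coboundaries_add) (simp_all add: mem_cohomology_class)
  then have "\<alpha> - (\<phi> - \<eta>) \<in> coboundaries ori L k"
    by (simp only: diff_diff_eq2 diff_add_eq)
  ultimately have "\<phi> - \<eta> \<in> cohomology_class ori L k \<alpha>"
    using assms(3) by (simp add: mem_cohomology_class)
  moreover have "cochain_restrict K k (\<phi> - \<eta>) = 0"
    by (simp add: cochain_restrict_diff \<eta>(2))
  ultimately show ?thesis
    by (rule that)
qed


section \<open>Cochains of minimal norm\<close>

lemma cochain_inner_diff_left:
  "cochain_inner X k (\<phi> - \<psi>) \<chi> = cochain_inner X k \<phi> \<chi> - cochain_inner X k \<psi> \<chi>"
  by (simp add: cochain_inner_def left_diff_distrib sum_subtractf)

lemma cochain_inner_scale_left: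
  "cochain_inner X k (\<lambda>\<sigma>. c * \<phi> \<sigma>) \<chi> = c * cochain_inner X k \<phi> \<chi>"
  by (simp add: cochain_inner_def mult.assoc sum_distrib_left)

lemma cochain_inner_commute: "cochain_inner X k \<phi> \<psi> = cochain_inner X k \<psi> \<phi>"
  by (simp add: cochain_inner_def mult.commute)

lemma cochain_inner_self_nonneg: "0 \<le> cochain_inner X k \<phi> \<phi>"
  by (simp add: cochain_inner_def sum_nonneg)

text \<open>A vanishing sum of squares has vanishing terms. Values off the
  \<open>k\<close>-simplices are invisible to the inner product, hence the pointwise form.\<close>

lemma cochain_inner_self_eq_0:
  assumes "finite X" "cochain_inner X k \<phi> \<phi> = 0" "\<sigma> \<in> simplices X k"
  shows "\<phi> \<sigma> = 0"
proof -
  have "finite (simplices X k)"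
    using assms(1) by (simp add: simplices_def)
  then show ?thesis
    using assms(2,3) by (simp add: cochain_inner_def sum_nonneg_eq_0_iff)
qed

text \<open>
  Induction on the set \<open>S\<close> supporting \<open>W\<close>: the elements of \<open>W\<close> vanishing at a given simplex form a
  subspace of codimension at most one, to which a Gram-Schmidt step adds one orthogonal vector.
\<close>

lemma orthogonal_projection_exists:
  fixes W :: "'a cochain set"
  assumes "finite X" "finite S" "S \<subseteq> simplices X k"
    and "0 \<in> W" "\<And>v w. v \<in> W \<Longrightarrow> w \<in> W \<Longrightarrow> v - w \<in> W" "\<And>c v. v \<in> W \<Longrightarrow> (\<lambda>\<sigma>. c * v \<sigma>) \<in> W"
    and "\<And>v \<sigma>. v \<in> W \<Longrightarrow> \<sigma> \<notin> S \<Longrightarrow> v \<sigma> = 0"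
  shows "\<exists>w\<in>W. \<forall>v\<in>W. cochain_inner X k (x - w) v = 0"
  using assms(2-)
proof (induction S arbitrary: W x rule: finite_induct)
  case empty
  then have "v = 0" if "v \<in> W" for v
    using that by (auto simp: fun_eq_iff)
  then have "cochain_inner X k (x - 0) v = 0" if "v \<in> W" for v
    using that by (fastforce simp: cochain_inner_def)
  then show ?case
    using empty.prems(2) by blast
next
  case (insert s S)
  note diff = insert.prems(3) and scale = insert.prems(4)
  let ?V = "{w \<in> W. w s = 0}"
  \<comment> \<open>The projection onto \<open>?V\<close> is needed for two vectors: one outside
    \<open>?V\<close>, to build \<open>u\<close>, and \<open>x\<close> itself.\<close>
  have proj: "\<exists>w\<in>?V. \<forall>v\<in>?V. cochain_inner X k (y - w) v = 0" for y
  proof (rule insert.IH)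
    show "v \<sigma> = 0" if "v \<in> ?V" "\<sigma> \<notin> S" for v \<sigma>
      using that insert.prems(5) by (cases "\<sigma> = s") auto
  qed (use insert.prems in auto)
  show ?case
  proof (cases "?V = W")
    case True
    then show ?thesis using proj by metis
  next
    case False
    then obtain y where y: "y \<in> W" "y s \<noteq> 0" by auto
    obtain y' where y': "y' \<in> ?V" "\<forall>v\<in>?V. cochain_inner X k (y - y') v = 0"
      using proj by blast
    \<comment> \<open>Gram-Schmidt: \<open>u\<close> is orthogonal to \<open>?V\<close>, and it is
      nonzero at \<open>s\<close> because \<open>y'\<close> vanishes there.\<close>
    define u where "u = y - y'"
    have "u \<in> W"
      unfolding u_def using y(1) y'(1) by (intro diff) auto
    moreover have "u s \<noteq> 0" "\<And>v. v \<in> ?V \<Longrightarrow> cochain_inner X k u v = 0"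
      using y y' by (auto simp: u_def)
    ultimately have u: "u \<in> W" "u s \<noteq> 0" "\<And>v. v \<in> ?V \<Longrightarrow> cochain_inner X k u v = 0"
      by blast+
    have uu: "cochain_inner X k u u \<noteq> 0"
      using cochain_inner_self_eq_0[OF assms(1)] u(2) insert.prems(1) by blast
    obtain x' where x': "x' \<in> ?V" "\<forall>v\<in>?V. cochain_inner X k (x - x') v = 0"
      using proj by blast
    \<comment> \<open>\<open>c\<close> is the coefficient of \<open>x\<close> along
      \<open>u\<close>, and \<open>w\<close> is \<open>x' + c u\<close>, written as a difference to
      fit the closure assumptions on \<open>W\<close>.\<close>
    define c where "c = cochain_inner X k x u / cochain_inner X k u u"
    define w where "w = x' - (\<lambda>\<sigma>. - c * u \<sigma>)"
    have "w \<in> W"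
      unfolding w_def using x'(1) diff scale[OF u(1), of "- c"] by blast
    moreover have ip: "cochain_inner X k (x - w) v
        = cochain_inner X k (x - x') v - c * cochain_inner X k u v" for v
      unfolding w_def cochain_inner_diff_left cochain_inner_scale_left by simp
    have "cochain_inner X k (x - w) v = 0" if v: "v \<in> W" for v
    proof -
      \<comment> \<open>This \<open>d\<close> makes \<open>v - d u\<close> vanish at
        \<open>s\<close>, so \<open>v\<close> splits into an element of \<open>?V\<close> and a
        multiple of \<open>u\<close>; orthogonality is checked on each.\<close>
      define d where "d = v s / u s"
      define v' where "v' = v - (\<lambda>\<sigma>. d * u \<sigma>)"
      have "v' \<in> W"
        unfolding v'_def by (intro diff v scale u(1))
      moreover have "v' s = 0"
        using u(2) by (simp add: v'_def d_def)
      ultimately have v': "v' \<in> ?V"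
        by simp
      have "cochain_inner X k (x - w) v' = 0"
        using v' x'(2) u(3) by (simp add: ip)
      moreover have "cochain_inner X k x' u = 0"
        using u(3)[OF x'(1)] by (simp add: cochain_inner_commute)
      then have "cochain_inner X k (x - w) u = 0"
        using uu unfolding ip by (simp add: cochain_inner_diff_left c_def)
      moreover have "cochain_inner X k v' (x - w)
          = cochain_inner X k v (x - w) - d * cochain_inner X k u (x - w)"
        unfolding v'_def cochain_inner_diff_left cochain_inner_scale_left ..
      ultimately show ?thesis
        by (simp add: cochain_inner_commute)
    qed
    ultimately show ?thesis by blast
  qed
qed

text \<open>The admissible \<open>\<beta>\<close> form the translate of \<open>W\<close> through
  \<open>\<gamma>\<close>; the minimiser is the component of \<open>\<gamma>\<close> orthogonal to
  \<open>W\<close>.\<close>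

lemma ex1_minimal_norm_translate:
  fixes W :: "'a cochain set"
  assumes "finite X" "W \<subseteq> cochains X k"
    and "0 \<in> W" "\<And>v w. v \<in> W \<Longrightarrow> w \<in> W \<Longrightarrow> v - w \<in> W" "\<And>c v. v \<in> W \<Longrightarrow> (\<lambda>\<sigma>. c * v \<sigma>) \<in> W"
  shows "\<exists>!\<beta>. is_arg_min (cochain_norm X k) (\<lambda>\<beta>. \<gamma> - \<beta> \<in> W) \<beta>"
proof -
  have "finite (simplices X k)"
    using assms(1) by (simp add: simplices_def)
  then obtain w where w: "w \<in> W" "\<And>v. v \<in> W \<Longrightarrow> cochain_inner X k (\<gamma> - w) v = 0"
    using orthogonal_projection_exists[OF assms(1) _ order_refl assms(3-5), of k \<gamma>] assms(2)
    unfolding cochains_def by blast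
  define m where "m = \<gamma> - w"
  have m: "\<gamma> - m \<in> W"
    using w(1) by (simp add: m_def)
  have in_W: "\<beta> - m \<in> W" if "\<gamma> - \<beta> \<in> W" for \<beta>
    using assms(4)[OF m that] by (simp add: algebra_simps)
  \<comment> \<open>Pythagoras: \<open>m\<close> is orthogonal to \<open>\<beta> - m\<close>, which
    lies in \<open>W\<close>. Minimality and uniqueness of \<open>m\<close> both follow from
    it.\<close>
  have pyth: "cochain_inner X k \<beta> \<beta> = cochain_inner X k m m + cochain_inner X k (\<beta> - m) (\<beta> - m)"
    if "\<gamma> - \<beta> \<in> W" for \<beta>
  proof -
    have "cochain_inner X k m (\<beta> - m) = 0"
      using w(2)[OF in_W[OF that]] by (simp add: m_def)
    moreover have "cochain_inner X k (\<beta> - m) (\<beta> - m) =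
        cochain_inner X k \<beta> (\<beta> - m) - cochain_inner X k m (\<beta> - m)"
      by (rule cochain_inner_diff_left)
    moreover have "cochain_inner X k \<beta> (\<beta> - m) = cochain_inner X k \<beta> \<beta> - cochain_inner X k m \<beta>"
      unfolding cochain_inner_commute[of X k \<beta> "\<beta> - m"] by (rule cochain_inner_diff_left)
    moreover have "cochain_inner X k m (\<beta> - m) = cochain_inner X k m \<beta> - cochain_inner X k m m"
      unfolding cochain_inner_commute[of X k m "\<beta> - m"] cochain_inner_commute[of X k m \<beta>]
      by (rule cochain_inner_diff_left)
    ultimately show ?thesis by linarith
  qed
  show ?thesis
  proof (rule ex1I)
    show "is_arg_min (cochain_norm X k) (\<lambda>\<beta>. \<gamma> - \<beta> \<in> W) m"
      unfolding is_arg_min_def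
    proof (intro conjI m notI)
      assume "\<exists>\<beta>. \<gamma> - \<beta> \<in> W \<and> cochain_norm X k \<beta> < cochain_norm X k m"
      then obtain \<beta> where \<beta>: "\<gamma> - \<beta> \<in> W" "cochain_norm X k \<beta> < cochain_norm X k m"
        by blast
      then have "cochain_inner X k \<beta> \<beta> < cochain_inner X k m m"
        by (simp add: cochain_norm_def)
      with pyth[OF \<beta>(1)] cochain_inner_self_nonneg[of X k "\<beta> - m"] show False
        by linarith
    qed
  next
    fix \<beta> assume \<beta>: "is_arg_min (cochain_norm X k) (\<lambda>\<beta>. \<gamma> - \<beta> \<in> W) \<beta>"
    then have \<beta>_W: "\<gamma> - \<beta> \<in> W"
      by (simp add: is_arg_min_def)
    have "\<not> cochain_norm X k m < cochain_norm X k \<beta>"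
      using \<beta> m unfolding is_arg_min_def by blast
    then have "cochain_inner X k \<beta> \<beta> \<le> cochain_inner X k m m"
      by (simp add: cochain_norm_def)
    then have "cochain_inner X k (\<beta> - m) (\<beta> - m) = 0"
      using pyth[OF \<beta>_W] cochain_inner_self_nonneg[of X k "\<beta> - m"] by linarith
    note vanish = cochain_inner_self_eq_0[OF assms(1) this]
    \<comment> \<open>Zero norm gives vanishing on the \<open>k\<close>-simplices only; being a
      cochain gives it everywhere else.\<close>
    have "\<beta> - m \<in> cochains X k"
      using in_W[OF \<beta>_W] assms(2) by (rule subsetD[rotated])
    then have "(\<beta> - m) \<sigma> = 0" for \<sigma>
      using vanish unfolding cochains_def by blast
    then show "\<beta> = m" by (simp add: fun_eq_iff)
  qed
qed

theorem proposition4p1: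
  fixes K L :: "'a set set"
    and ori :: "'a set \<Rightarrow> 'a list"
    and k :: nat
    and \<alpha> :: "'a cochain"
  assumes "subcomplex K L"
    and "orientation L ori"
    and "\<alpha> \<in> cocycles ori L k"
    and "born_between ori K L k (cohomology_class ori L k \<alpha>)"
  shows "{\<beta>. is_arg_min (cochain_norm L k)
               (\<lambda>\<alpha>'. \<alpha>' \<in> rel_cocycles ori L K k \<and>
                     q_sharp ori L k (rel_cohomology_class ori L K k \<alpha>') =
                       cohomology_class ori L k \<alpha>) \<beta>}
         = {birth_cochain ori K L k (cohomology_class ori L k \<alpha>)}"
proof -
  have L: "simplicial_complex L"
    using assms(1) by (simp add: subcomplex_def)
  define W where "W = {w \<in> coboundaries ori L k. cochain_restrict K k w = 0}"
  \<comment> \<open>\<open>P\<close> is the constraint from \<open>birth_cochain\<close>, and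
    \<open>W\<close> is the direction space of its solution set.\<close>
  define P where "P \<beta> \<longleftrightarrow> \<beta> \<in> cochains L k \<and> cochain_restrict K k \<beta> = 0 \<and>
    \<beta> \<in> cohomology_class ori L k \<alpha>" for \<beta>
  obtain \<gamma> where \<gamma>: "\<gamma> \<in> cohomology_class ori L k \<alpha>" "cochain_restrict K k \<gamma> = 0"
    using born_between_representative[OF assms] .
  have cob: "coboundaries ori L k \<subseteq> cocycles ori L k"
    using coboundaries_subset_cocycles[OF L assms(2)] .
  have P_iff: "P \<beta> \<longleftrightarrow> \<gamma> - \<beta> \<in> W" for \<beta>
  proof -
    have \<gamma>_coc: "\<gamma> \<in> cocycles ori L k"
      using \<gamma>(1) by (simp add: mem_cohomology_class)
    have "cohomology_class ori L k \<alpha> = cohomology_class ori L k \<gamma>"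
      using cohomology_class_eq_iff[OF assms(3)] \<gamma>(1) by metis
    \<comment> \<open>Here \<open>\<beta>\<close> is recovered as
      \<open>\<gamma> - (\<gamma> - \<beta>)\<close>, a difference of cocycles.\<close>
    moreover have "\<beta> \<in> cocycles ori L k" if "\<gamma> - \<beta> \<in> coboundaries ori L k"
      using cocycles_diff[OF \<gamma>_coc subsetD[OF cob that]] by simp
    ultimately have "P \<beta> \<longleftrightarrow> cochain_restrict K k \<beta> = 0 \<and> \<gamma> - \<beta> \<in> coboundaries ori L k"
      using \<gamma>_coc by (auto simp: P_def mem_cohomology_class cocycles_def)
    then show ?thesis
      using \<gamma>(2) by (auto simp: W_def cochain_restrict_diff)
  qed
  have "\<exists>!\<beta>. is_arg_min (cochain_norm L k) (\<lambda>\<beta>. \<gamma> - \<beta> \<in> W) \<beta>"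
  proof (rule ex1_minimal_norm_translate)
    show "finite L"
      using L by (simp add: simplicial_complex_def)
    show "W \<subseteq> cochains L k"
      using cob by (auto simp: W_def cocycles_def)
    show "0 \<in> W"
      by (simp add: W_def zero_in_coboundaries cochain_restrict_def fun_eq_iff)
    show "v - w \<in> W" if "v \<in> W" "w \<in> W" for v w
      using that by (simp add: W_def coboundaries_diff cochain_restrict_diff)
    show "(\<lambda>\<sigma>. c * v \<sigma>) \<in> W" if "v \<in> W" for c v
    proof -
      have "cochain_restrict K k (\<lambda>\<sigma>. c * v \<sigma>) \<sigma> = c * cochain_restrict K k v \<sigma>" for \<sigma>
        by (simp add: cochain_restrict_def)
      then show ?thesis
        using that coboundaries_scale[of v ori L k c] by (simp add: W_def fun_eq_iff)
    qed
  qed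
  then have ex1: "\<exists>!\<beta>. is_arg_min (cochain_norm L k) P \<beta>"
    using P_iff by (simp add: is_arg_min_def)
  have "is_arg_min (cochain_norm L k) P (birth_cochain ori K L k (cohomology_class ori L k \<alpha>))"
    using theI'[OF ex1] unfolding birth_cochain_def P_def .
  \<comment> \<open>Both constraints are now the same predicate, so the unique minimiser picked out
    by \<open>birth_cochain\<close> is the only element of the set.\<close>
  moreover have "(\<lambda>\<alpha>'. \<alpha>' \<in> rel_cocycles ori L K k \<and>
      q_sharp ori L k (rel_cohomology_class ori L K k \<alpha>') = cohomology_class ori L k \<alpha>) = P"
    using rel_cocycle_class_iff[OF assms(3)] by (simp add: P_def fun_eq_iff)
  ultimately show ?thesis
    using ex1 by auto
qed

end
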